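(* Let $(\Omega,\Sigma,\mu)$ be a measure space and $\mathbb{K}=\mathbb{C}$ or $\mathbb{R}$. If $f,g,h\in L^2(\Omega,\mathbb{K})$ and $\varphi,\Phi,\gamma,\Gamma\in\mathbb{K}$ are such that $\operatorname{Re}(\Phi\overline{\varphi})>0$, $\operatorname{Re}(\Gamma\overline{\gamma})>0$, $\int_\Omega|h(s)|^2\,d\mu(s)=1$ and $$\int_\Omega\operatorname{Re}\left[(\Phi h(s)-f(s))\left(\overline{f(s)}-\overline{\varphi}\,\overline{h(s)}\right)\right]d\mu(s)\ge0,$$ $$\int_\Omega\operatorname{Re}\left[(\Gamma h(s)-g(s))\left(\overline{g(s)}-\overline{\gamma}\,\overline{h(s)}\right)\right]d\mu(s)\ge0,$$ or, equivalently, $$\left(\int_\Omega\left|f(s)-\frac{\Phi+\varphi}{2}h(s)\right|^2d\mu(s)\right)^{1/2}\le\frac12|\Phi-\varphi|,\qquad \left(\int_\Omega\left|g(s)-\frac{\Gamma+\gamma}{2}h(s)\right|^2d\mu(s)\right)^{1/2}\le\frac12|\Gamma-\gamma|,$$ then $$\left|\int_\Omega f(s)\overline{g(s)}\,d\mu(s)-\int_\Omega f(s)\overline{h(s)}\,d\mu(s)\int_\Omega h(s)\overline{g(s)}\,d\mu(s)\right|\le\frac14M(\varphi,\Phi)M(\gamma,\Gamma)\left|\int_\Omega f(s)\overline{h(s)}\,d\mu(s)\int_\Omega h(s)\overline{g(s)}\,d\mu(s)\right|,$$ where $$M(\varphi,\Phi):=\left[\frac{(|\Phi|-|\varphi|)^2+4\left[|\Phi\overline{\varphi}|-\operatorname{Re}(\Phi\overline{\varphi})\right]}{\operatorname{Re}(\Phi\overline{\varphi})}\right]^{1/2}$$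 and $M(\gamma,\Gamma)$ is defined by the same formula with $(\gamma,\Gamma)$ in place of $(\varphi,\Phi)$. The constant $\frac14$ is best possible (i.e. no constant smaller than $\frac14$ makes the inequality valid for all such measure spaces, functions and scalars).
   Context: $(\Omega,\Sigma,\mu)$ consists of a set $\Omega$, a $\sigma$-algebra $\Sigma$ of subsets of $\Omega$ and a countably additive positive measure $\mu$ on $\Sigma$ with values in $\mathbb{R}\cup\{\infty\}$. $L^2(\Omega,\mathbb{K})$ is the Hilbert space of all $\mathbb{K}$-valued functions $f$ on $\Omega$ that are 2-integrable, i.e. $\int_\Omega|f(s)|^2\,d\mu(s)<\infty$. *)

theory Defs
  imports "HOL-Analysis.Analysis"
begin

text \<open>
  The scalar field is a set \<open>K\<close> of complex numbers, to be instantiated with \<open>UNIV\<close> or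
  \<open>\<real>\<close>; real-valued functions are complex functions with values in \<open>\<real>\<close>. Elements of
  \<open>L\<^sup>2\<close> are represented by functions rather than by classes modulo null sets.
\<close>

definition L2 :: "'a measure \<Rightarrow> complex set \<Rightarrow> ('a \<Rightarrow> complex) set" where
  "L2 M K = {f \<in> borel_measurable M.
     (\<forall>s\<in>space M. f s \<in> K) \<and> integrable M (\<lambda>s. (cmod (f s))\<^sup>2)}"

definition gruess_data ::
    "complex set \<Rightarrow> 'a measure \<Rightarrow> ('a \<Rightarrow> complex) \<Rightarrow> ('a \<Rightarrow> complex) \<Rightarrow> ('a \<Rightarrow> complex) \<Rightarrow>
     complex \<Rightarrow> complex \<Rightarrow> complex \<Rightarrow> complex \<Rightarrow> bool" where
  "gruess_data K M f g h \<phi> \<Phi> \<gamma> \<Gamma> \<longleftrightarrow>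
     f \<in> L2 M K \<and> g \<in> L2 M K \<and> h \<in> L2 M K \<and>
     \<phi> \<in> K \<and> \<Phi> \<in> K \<and> \<gamma> \<in> K \<and> \<Gamma> \<in> K \<and>
     Re (\<Phi> * cnj \<phi>) > 0 \<and> Re (\<Gamma> * cnj \<gamma>) > 0 \<and>
     (\<integral>s. (cmod (h s))\<^sup>2 \<partial>M) = 1"

definition accretive_cond ::
    "'a measure \<Rightarrow> ('a \<Rightarrow> complex) \<Rightarrow> ('a \<Rightarrow> complex) \<Rightarrow> complex \<Rightarrow> complex \<Rightarrow> bool" where
  "accretive_cond M h f \<phi> \<Phi> \<longleftrightarrow>
     (\<integral>s. Re ((\<Phi> * h s - f s) * (cnj (f s) - cnj \<phi> * cnj (h s))) \<partial>M) \<ge> 0"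

definition ball_cond ::
    "'a measure \<Rightarrow> ('a \<Rightarrow> complex) \<Rightarrow> ('a \<Rightarrow> complex) \<Rightarrow> complex \<Rightarrow> complex \<Rightarrow> bool" where
  "ball_cond M h f \<phi> \<Phi> \<longleftrightarrow>
     sqrt (\<integral>s. (cmod (f s - (\<Phi> + \<phi>) / 2 * h s))\<^sup>2 \<partial>M) \<le> 1 / 2 * cmod (\<Phi> - \<phi>)"

definition gruess_M :: "complex \<Rightarrow> complex \<Rightarrow> real" where
  "gruess_M \<phi> \<Phi> =
     sqrt (((cmod \<Phi> - cmod \<phi>)\<^sup>2 + 4 * (cmod (\<Phi> * cnj \<phi>) - Re (\<Phi> * cnj \<phi>))) / Re (\<Phi> * cnj \<phi>))"

definition gruess_ineq ::
    "real \<Rightarrow> 'a measure \<Rightarrow> ('a \<Rightarrow> complex) \<Rightarrow> ('a \<Rightarrow> complex) \<Rightarrow> ('a \<Rightarrow> complex) \<Rightarrow>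
     complex \<Rightarrow> complex \<Rightarrow> complex \<Rightarrow> complex \<Rightarrow> bool" where
  "gruess_ineq C M f g h \<phi> \<Phi> \<gamma> \<Gamma> \<longleftrightarrow>
     cmod ((\<integral>s. f s * cnj (g s) \<partial>M) - (\<integral>s. f s * cnj (h s) \<partial>M) * (\<integral>s. h s * cnj (g s) \<partial>M))
     \<le> C * gruess_M \<phi> \<Phi> * gruess_M \<gamma> \<Gamma> *
       cmod ((\<integral>s. f s * cnj (h s) \<partial>M) * (\<integral>s. h s * cnj (g s) \<partial>M))"

end

theory Submission
  imports Defs
begin

text \<open>
  Write \<open>\<langle>u, v\<rangle>\<close> for the integral of \<open>u\<close> times the conjugate of \<open>v\<close>. Since \<open>h\<close> is a unit vector,
  the left-hand side of the inequality is the modulus of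
  \<open>\<langle>f - \<langle>f, h\<rangle> h, g - \<langle>g, h\<rangle> h\<rangle>\<close>. By Cauchy--Schwarz it suffices to bound
  \<open>\<parallel>f\<parallel>\<^sup>2 - \<bar>\<langle>f, h\<rangle>\<bar>\<^sup>2\<close>. Expanding the first hypothesis gives
  \<open>\<parallel>f\<parallel>\<^sup>2 \<le> S a - R\<close>, where \<open>a = \<bar>\<langle>f, h\<rangle>\<bar>\<close>, \<open>S = \<bar>\<Phi>\<bar> + \<bar>\<phi>\<bar>\<close> and \<open>R = Re (\<Phi> \<phi>*)\<close>, and
  \<open>S a - R \<le> S\<^sup>2 a\<^sup>2 / (4 R) = (1 + M\<^sup>2 / 4) a\<^sup>2\<close> by AM--GM.
  All these estimates are equalities for suitable \<open>f = g\<close> on a two-point space, with \<open>\<phi>\<close> and \<open>\<Phi>\<close>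
  positive and \<open>f / h\<close> taking only the values \<open>\<phi>\<close> and \<open>\<Phi>\<close>.
\<close>

section \<open>Inner product on square-integrable functions and Cauchy-Schwarz\<close>

definition l2_inner :: "'a measure \<Rightarrow> ('a \<Rightarrow> complex) \<Rightarrow> ('a \<Rightarrow> complex) \<Rightarrow> complex" where
  "l2_inner M f g = (\<integral>s. f s * cnj (g s) \<partial>M)"

lemma L2_mono: "K \<subseteq> K' \<Longrightarrow> L2 M K \<subseteq> L2 M K'"
  by (auto simp: L2_def)

lemma integrable_L2_mult_cnj:
  assumes "f \<in> L2 M K" "g \<in> L2 M K'"
  shows "integrable M (\<lambda>s. f s * cnj (g s))"
proof (rule Bochner_Integration.integrable_bound)
  show "integrable M (\<lambda>s. (cmod (f s))\<^sup>2 + (cmod (g s))\<^sup>2)"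
    using assms by (simp add: L2_def)
  have [measurable]: "f \<in> borel_measurable M" "g \<in> borel_measurable M"
    using assms by (auto simp: L2_def)
  show "(\<lambda>s. f s * cnj (g s)) \<in> borel_measurable M"
    by (intro borel_measurable_times borel_measurable_continuous_onI[THEN measurable_compose[rotated], of cnj]
        continuous_intros) measurable
  have "x * y \<le> x\<^sup>2 + y\<^sup>2" if "0 \<le> x" "0 \<le> y" for x y :: real
    using sum_squares_bound[of x y] mult_nonneg_nonneg[OF that] by linarith
  then show "AE s in M. norm (f s * cnj (g s)) \<le> norm ((cmod (f s))\<^sup>2 + (cmod (g s))\<^sup>2)"
    by (simp add: norm_mult)
qed

lemma L2_diff_scale:
  assumes "f \<in> L2 M UNIV" "h \<in> L2 M UNIV"
  shows "(\<lambda>s. f s - c * h s) \<in> L2 M UNIV"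
proof -
  have [measurable]: "f \<in> borel_measurable M" "h \<in> borel_measurable M"
    using assms by (auto simp: L2_def)
  \<comment> \<open>Each term of the expansion is a product handled by
    \<open>integrable_L2_mult_cnj\<close>.\<close>
  have "(cmod (f s - c * h s))\<^sup>2 =
      Re (f s * cnj (f s)) - 2 * Re (cnj c * (f s * cnj (h s))) + (cmod c)\<^sup>2 * Re (h s * cnj (h s))"
    for s
    by (simp add: cmod_power2) (simp add: algebra_simps power2_eq_square)
  moreover have "integrable M (\<lambda>s. Re (f s * cnj (f s)) - 2 * Re (cnj c * (f s * cnj (h s)))
      + (cmod c)\<^sup>2 * Re (h s * cnj (h s)))"
    using assms
    by (intro Bochner_Integration.integrable_add Bochner_Integration.integrable_diff
        integrable_mult_right integrable_Re integrable_L2_mult_cnj)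
  ultimately show ?thesis
    by (simp add: L2_def)
qed

lemma l2_inner_self: "l2_inner M f f = of_real (\<integral>s. (cmod (f s))\<^sup>2 \<partial>M)"
  unfolding l2_inner_def complex_norm_square[symmetric] by (rule integral_complex_of_real)

lemma cnj_l2_inner: "cnj (l2_inner M f g) = l2_inner M g f"
  unfolding l2_inner_def by (subst Bochner_Integration.integral_cnj[symmetric]) (simp add: mult.commute)

lemma l2_inner_diff_scale_left:
  assumes "f \<in> L2 M UNIV" "h \<in> L2 M UNIV" "g \<in> L2 M UNIV"
  shows "l2_inner M (\<lambda>s. f s - c * h s) g = l2_inner M f g - c * l2_inner M h g"
  using integrable_L2_mult_cnj[OF assms(1,3)] integrable_L2_mult_cnj[OF assms(2,3)]
  by (simp add: l2_inner_def left_diff_distrib mult.assoc)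

lemma l2_inner_diff_scale_right:
  assumes "f \<in> L2 M UNIV" "h \<in> L2 M UNIV" "g \<in> L2 M UNIV"
  shows "l2_inner M g (\<lambda>s. f s - c * h s) = l2_inner M g f - cnj c * l2_inner M g h"
  using arg_cong[OF l2_inner_diff_scale_left[OF assms, of c], of cnj]
  by (simp add: cnj_l2_inner)

lemma l2_inner_diff_scale:
  assumes "f \<in> L2 M UNIV" "g \<in> L2 M UNIV" "h \<in> L2 M UNIV" "k \<in> L2 M UNIV"
  shows "l2_inner M (\<lambda>s. f s - c * h s) (\<lambda>s. g s - d * k s) =
    l2_inner M f g - c * l2_inner M h g - cnj d * (l2_inner M f k - c * l2_inner M h k)"
  using assms
  by (simp add: l2_inner_diff_scale_left l2_inner_diff_scale_right L2_diff_scale algebra_simps)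

lemma l2_inner_Cauchy_Schwarz:
  assumes f: "f \<in> L2 M UNIV" and g: "g \<in> L2 M UNIV"
  shows "(cmod (l2_inner M f g))\<^sup>2 \<le> (\<integral>s. (cmod (f s))\<^sup>2 \<partial>M) * (\<integral>s. (cmod (g s))\<^sup>2 \<partial>M)"
proof -
  define U V w where "U = (\<integral>s. (cmod (f s))\<^sup>2 \<partial>M)" and "V = (\<integral>s. (cmod (g s))\<^sup>2 \<partial>M)"
    and "w = l2_inner M f g"
  have nonneg: "0 \<le> U" "0 \<le> V"
    by (simp_all add: U_def V_def)
  have quadratic: "0 \<le> U - 2 * t * (cmod w)\<^sup>2 + t\<^sup>2 * (cmod w)\<^sup>2 * V" for t :: real
  proof -
    \<comment> \<open>The factor \<open>w\<close> in \<open>c\<close> turns both cross terms into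
      the real number \<open>t * (cmod w)\<^sup>2\<close>.\<close>
    define c where "c = of_real t * w"
    have "of_real (\<integral>s. (cmod (f s - c * g s))\<^sup>2 \<partial>M) =
        of_real U - c * cnj w - cnj c * (w - c * of_real V)"
      unfolding l2_inner_self[symmetric] U_def V_def w_def cnj_l2_inner
      by (rule l2_inner_diff_scale) (use f g in auto)
    also have "\<dots> = of_real (U - 2 * t * (cmod w)\<^sup>2 + t\<^sup>2 * (cmod w)\<^sup>2 * V)"
      unfolding of_real_add of_real_diff of_real_mult complex_norm_square
      by (simp add: c_def power2_eq_square algebra_simps)
    finally have "(\<integral>s. (cmod (f s - c * g s))\<^sup>2 \<partial>M) = U - 2 * t * (cmod w)\<^sup>2 + t\<^sup>2 * (cmod w)\<^sup>2 * V"
      using of_real_eq_iff by blast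
    then show ?thesis
      by (metis (no_types, lifting) Bochner_Integration.integral_nonneg zero_le_power2)
  qed
  have "(cmod w)\<^sup>2 \<le> U * V"
  proof (cases "V = 0")
    case True
    have "w = 0"
    proof (rule ccontr)
      assume "w \<noteq> 0"
      \<comment> \<open>For \<open>V = 0\<close> the quadratic is linear in \<open>t\<close>; at
        this \<open>t\<close> it equals \<open>- U - 2\<close>.\<close>
      with quadratic[of "(U + 1) / (cmod w)\<^sup>2"] True nonneg show False
        by simp
    qed
    then show ?thesis
      using True by simp
  next
    case False
    \<comment> \<open>If \<open>w\<close> is nonzero, this \<open>t\<close> minimizes the
      quadratic.\<close>
    with quadratic[of "1 / V"] nonneg show ?thesis
      by (simp add: power2_eq_square field_simps)
  qed
  then show ?thesis
    by (simp add: U_def V_def w_def)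
qed

section \<open>Equivalence of the two forms of the hypothesis\<close>

text \<open>With p = (\<Phi> - \<phi>)/2 x and q = y - (\<Phi> + \<phi>)/2 x, the factors are p - q
  and the conjugate of p + q, and the real part of their product is |p|^2 - |q|^2.\<close>

lemma accretive_integrand_eq:
  "Re ((\<Phi> * x - y) * (cnj y - cnj \<phi> * cnj x)) =
    (cmod (\<Phi> - \<phi>) / 2)\<^sup>2 * (cmod x)\<^sup>2 - (cmod (y - (\<Phi> + \<phi>) / 2 * x))\<^sup>2"
  by (simp add: power_divide cmod_power2) (simp add: field_simps power2_eq_square)

lemma accretive_integral_eq:
  assumes "f \<in> L2 M UNIV" "h \<in> L2 M UNIV" "(\<integral>s. (cmod (h s))\<^sup>2 \<partial>M) = 1"
  shows "(\<integral>s. Re ((\<Phi> * h s - f s) * (cnj (f s) - cnj \<phi> * cnj (h s))) \<partial>M) =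
    (cmod (\<Phi> - \<phi>) / 2)\<^sup>2 - (\<integral>s. (cmod (f s - (\<Phi> + \<phi>) / 2 * h s))\<^sup>2 \<partial>M)"
  unfolding accretive_integrand_eq
  using assms L2_diff_scale[OF assms(1,2), of "(\<Phi> + \<phi>) / 2"]
  by (simp add: L2_def)

lemma accretive_cond_iff_ball_cond:
  assumes "f \<in> L2 M UNIV" "h \<in> L2 M UNIV" "(\<integral>s. (cmod (h s))\<^sup>2 \<partial>M) = 1"
  shows "accretive_cond M h f \<phi> \<Phi> \<longleftrightarrow> ball_cond M h f \<phi> \<Phi>"
proof -
  have sqrt_le: "sqrt x \<le> y \<longleftrightarrow> x \<le> y\<^sup>2" if "0 \<le> y" for x y
    using that by (metis abs_of_nonneg real_sqrt_abs real_sqrt_le_iff)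
  show ?thesis
    unfolding accretive_cond_def ball_cond_def accretive_integral_eq[OF assms]
    by (subst sqrt_le) (simp_all add: power_divide)
qed

section \<open>The upper bound with constant 1/4\<close>

lemma Re_mult_cnj_le: "Re (z * cnj w) \<le> cmod z * cmod w"
  using complex_Re_le_cmod[of "z * cnj w"] by (simp add: norm_mult)

lemma gruess_M_nonneg: "Re (\<Phi> * cnj \<phi>) > 0 \<Longrightarrow> 0 \<le> gruess_M \<phi> \<Phi>"
  using Re_mult_cnj_le[of \<Phi> \<phi>] by (simp add: gruess_M_def norm_mult)

text \<open>Adding 4|\<Phi>||\<phi>| to (|\<Phi>| - |\<phi>|)^2 completes it to (|\<Phi>| +
  |\<phi>|)^2. In this form the constant can be compared with the AM-GM bound.\<close>

lemma gruess_M_power2: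
  assumes "Re (\<Phi> * cnj \<phi>) > 0"
  shows "(gruess_M \<phi> \<Phi>)\<^sup>2 = (cmod \<Phi> + cmod \<phi>)\<^sup>2 / Re (\<Phi> * cnj \<phi>) - 4"
proof -
  have "(gruess_M \<phi> \<Phi>)\<^sup>2 =
      ((cmod \<Phi> - cmod \<phi>)\<^sup>2 + 4 * (cmod (\<Phi> * cnj \<phi>) - Re (\<Phi> * cnj \<phi>))) / Re (\<Phi> * cnj \<phi>)"
    unfolding gruess_M_def using assms Re_mult_cnj_le[of \<Phi> \<phi>]
    by (intro real_sqrt_pow2 divide_nonneg_pos add_nonneg_nonneg) (auto simp: norm_mult)
  also have "\<dots> = ((cmod \<Phi> + cmod \<phi>)\<^sup>2 - 4 * Re (\<Phi> * cnj \<phi>)) / Re (\<Phi> * cnj \<phi>)"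
    by (simp add: norm_mult power2_eq_square algebra_simps)
  also have "\<dots> = (cmod \<Phi> + cmod \<phi>)\<^sup>2 / Re (\<Phi> * cnj \<phi>) - 4"
    by (simp only: diff_divide_distrib nonzero_mult_div_cancel_right[OF assms[THEN less_imp_neq, THEN not_sym]])
  finally show ?thesis .
qed

lemma reverse_Schwarz:
  assumes f: "f \<in> L2 M UNIV" and h: "h \<in> L2 M UNIV" and h1: "(\<integral>s. (cmod (h s))\<^sup>2 \<partial>M) = 1"
    and R: "Re (\<Phi> * cnj \<phi>) > 0" and acc: "accretive_cond M h f \<phi> \<Phi>"
  shows "(\<integral>s. (cmod (f s))\<^sup>2 \<partial>M) - (cmod (l2_inner M f h))\<^sup>2
    \<le> (1 / 2 * gruess_M \<phi> \<Phi> * cmod (l2_inner M f h))\<^sup>2"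
proof -
  define F w R S c where "F = (\<integral>s. (cmod (f s))\<^sup>2 \<partial>M)" and "w = l2_inner M f h"
    and "R = Re (\<Phi> * cnj \<phi>)" and "S = cmod \<Phi> + cmod \<phi>" and "c = (\<Phi> + \<phi>) / 2"
  have R_pos: "0 < R"
    unfolding R_def by (rule R)
  have "of_real (\<integral>s. (cmod (f s - c * h s))\<^sup>2 \<partial>M) =
      of_real F - c * cnj w - cnj c * (w - c * of_real 1)"
    unfolding l2_inner_self[symmetric] F_def w_def cnj_l2_inner h1[symmetric]
    by (rule l2_inner_diff_scale) (use f h in auto)
  then have "(\<integral>s. (cmod (f s - c * h s))\<^sup>2 \<partial>M) = Re (of_real F - c * cnj w - cnj c * (w - c * of_real 1))"
    by (metis Re_complex_of_real)
  moreover have "(\<integral>s. (cmod (f s - c * h s))\<^sup>2 \<partial>M) \<le> (cmod (\<Phi> - \<phi>) / 2)\<^sup>2"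
    using acc unfolding accretive_cond_def accretive_integral_eq[OF f h h1] c_def by simp
  \<comment> \<open>The term \<open>R\<close> arises from |\<Phi> - \<phi>|^2/4 - |\<Phi> +
    \<phi>|^2/4 = -Re(\<Phi> \<open>cnj\<close> \<phi>).\<close>
  moreover have "(cmod (\<Phi> - \<phi>) / 2)\<^sup>2 - Re (of_real F - c * cnj w - cnj c * (w - c * of_real 1)) =
      Re ((\<Phi> + \<phi>) * cnj w) - R - F"
    unfolding c_def R_def
    by (simp add: power_divide cmod_power2) (simp add: field_simps power2_eq_square)
  ultimately have "F \<le> Re ((\<Phi> + \<phi>) * cnj w) - R"
    by linarith
  also have "Re ((\<Phi> + \<phi>) * cnj w) \<le> S * cmod w"
    using Re_mult_cnj_le[of "\<Phi> + \<phi>" w] mult_right_mono[OF norm_triangle_ineq[of \<Phi> \<phi>], of "cmod w"]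
    by (simp add: S_def)
  finally have "F \<le> S * cmod w - R"
    by simp
  also have "\<dots> \<le> S\<^sup>2 * (cmod w)\<^sup>2 / (4 * R)"
  proof -
    \<comment> \<open>Dividing this square by \<open>4 * R\<close> gives exactly the difference of
      the two sides.\<close>
    have "0 \<le> (S * cmod w - 2 * R)\<^sup>2"
      by simp
    then show ?thesis
      using R_pos by (simp add: field_simps power2_eq_square)
  qed
  also have "\<dots> = (1 / 2 * gruess_M \<phi> \<Phi> * cmod w)\<^sup>2 + (cmod w)\<^sup>2"
    unfolding power_mult_distrib gruess_M_power2[OF R]
    unfolding R_def[symmetric] S_def[symmetric]
    using R_pos by (simp add: field_simps power2_eq_square)
  finally show ?thesis
    by (simp add: F_def w_def)
qed

theorem gruess_inequality:
  assumes f: "f \<in> L2 M UNIV" and g: "g \<in> L2 M UNIV" and h: "h \<in> L2 M UNIV"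
    and h1: "(\<integral>s. (cmod (h s))\<^sup>2 \<partial>M) = 1"
    and R: "Re (\<Phi> * cnj \<phi>) > 0" "Re (\<Gamma> * cnj \<gamma>) > 0"
    and acc: "accretive_cond M h f \<phi> \<Phi>" "accretive_cond M h g \<gamma> \<Gamma>"
  shows "gruess_ineq (1 / 4) M f g h \<phi> \<Phi> \<gamma> \<Gamma>"
proof -
  define a b where "a = l2_inner M f h" and "b = l2_inner M g h"
  have hh: "l2_inner M h h = 1"
    by (simp add: l2_inner_self h1)
  \<comment> \<open>Pythagoras for the orthogonal projection of \<open>u\<close> onto the line
    spanned by the unit vector \<open>h\<close>.\<close>
  have dist: "(\<integral>s. (cmod (u s - l2_inner M u h * h s))\<^sup>2 \<partial>M) =
      (\<integral>s. (cmod (u s))\<^sup>2 \<partial>M) - (cmod (l2_inner M u h))\<^sup>2" if "u \<in> L2 M UNIV" for u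
  proof -
    have "complex_of_real (\<integral>s. (cmod (u s - l2_inner M u h * h s))\<^sup>2 \<partial>M) =
        of_real ((\<integral>s. (cmod (u s))\<^sup>2 \<partial>M) - (cmod (l2_inner M u h))\<^sup>2)"
      unfolding l2_inner_self[symmetric] of_real_diff l2_inner_diff_scale[OF that that h h] hh
        complex_norm_square
      by (simp add: cnj_l2_inner)
    then show ?thesis
      using of_real_eq_iff by blast
  qed
  let ?u = "\<lambda>s. f s - a * h s" and ?v = "\<lambda>s. g s - b * h s"
  let ?X = "1 / 2 * gruess_M \<phi> \<Phi> * cmod a" and ?Y = "1 / 2 * gruess_M \<gamma> \<Gamma> * cmod b"
  have "(cmod (l2_inner M ?u ?v))\<^sup>2 \<le> (\<integral>s. (cmod (?u s))\<^sup>2 \<partial>M) * (\<integral>s. (cmod (?v s))\<^sup>2 \<partial>M)"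
    using f g h by (intro l2_inner_Cauchy_Schwarz L2_diff_scale)
  also have "\<dots> \<le> ?X\<^sup>2 * ?Y\<^sup>2"
    using reverse_Schwarz[OF f h h1 R(1) acc(1)] reverse_Schwarz[OF g h h1 R(2) acc(2)]
    unfolding a_def b_def dist[OF f, symmetric] dist[OF g, symmetric]
    by (intro mult_mono) simp_all
  finally have "(cmod (l2_inner M ?u ?v))\<^sup>2 \<le> (?X * ?Y)\<^sup>2"
    by (simp only: power_mult_distrib)
  then have "cmod (l2_inner M ?u ?v) \<le> ?X * ?Y"
    by (rule power2_le_imp_le) (use R in \<open>simp add: gruess_M_nonneg\<close>)
  \<comment> \<open>The term with factor \<open>cnj b\<close> vanishes, because \<open>?u\<close> is
    orthogonal to \<open>h\<close>.\<close>
  moreover have "l2_inner M ?u ?v = l2_inner M f g - l2_inner M f h * l2_inner M h g"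
    using l2_inner_diff_scale[OF f g h h, of a b] by (simp add: hh a_def)
  moreover have "cmod b = cmod (l2_inner M h g)"
    unfolding b_def by (metis cnj_l2_inner complex_mod_cnj)
  ultimately show ?thesis
    by (simp add: gruess_ineq_def a_def norm_mult mult_ac flip: l2_inner_def)
qed

section \<open>Sharpness of the constant\<close>

text \<open>
  Equality in AM--GM forces the weight \<open>\<bar>h\<bar>\<^sup>2\<close> at the point where \<open>f / h = \<phi>\<close> to be
  \<open>\<Phi> / (\<Phi> + \<phi>)\<close>; for \<open>\<phi> = 9\<close> and \<open>\<Phi> = 16\<close> both weights are squares of rationals.
\<close>

lemma gruess_ineq_best_constant:
  fixes f h :: "real \<Rightarrow> complex" and M :: "real measure"
  defines "M \<equiv> count_space {0, 1}"
  defines "h \<equiv> \<lambda>s. if s = 0 then 4 / 5 else 3 / 5"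
  defines "f \<equiv> \<lambda>s. if s = 0 then 36 / 5 else 48 / 5"
  assumes "K = UNIV \<or> K = \<real>"
  shows "gruess_data K M f f h 9 16 9 16" "accretive_cond M h f 9 16"
    "gruess_ineq C M f f h 9 16 9 16 \<Longrightarrow> 1 / 4 \<le> C"
proof -
  \<comment> \<open>All values and scalars of the example are real, so it serves both choices of
    \<open>K\<close>.\<close>
  have K: "r \<in> K" if "r \<in> \<real>" for r
    using assms(4) that by auto
  have L2: "u \<in> L2 M K" if "u 0 \<in> K" "u 1 \<in> K" for u
    using that by (auto simp: M_def L2_def intro: integrable_count_space)
  have int: "(\<integral>s. u s \<partial>M) = u 0 + u 1" for u :: "real \<Rightarrow> complex"
    by (simp add: M_def lebesgue_integral_count_space_finite)
  have intr: "(\<integral>s. u s \<partial>M) = u 0 + u 1" for u :: "real \<Rightarrow> real"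
    by (simp add: M_def lebesgue_integral_count_space_finite)
  show "gruess_data K M f f h 9 16 9 16"
    unfolding gruess_data_def intr
    by (auto intro!: L2 K simp: f_def h_def norm_divide power2_eq_square)
  \<comment> \<open>The integrand vanishes identically: \<open>f = 9 * h\<close> at 0 and
    \<open>f = 16 * h\<close> at 1.\<close>
  show "accretive_cond M h f 9 16"
    unfolding accretive_cond_def intr by (simp add: f_def h_def)
  have M2: "gruess_M 9 16 * gruess_M 9 16 = 49 / 144"
    using gruess_M_power2[of 16 9] by (simp add: power2_eq_square)
  assume "gruess_ineq C M f f h 9 16 9 16"
  \<comment> \<open>Here the squared norm of \<open>f\<close> is 144 and its inner product with
    \<open>h\<close> is 288/25, so the inequality reads 7056/625 \<le> C * 28224/625.\<close>
  then show "1 / 4 \<le> C"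
    unfolding gruess_ineq_def int
    by (simp add: f_def h_def mult.assoc[of C] M2 norm_mult norm_divide)
qed

text \<open>Optimality is stated over \<open>real\<close>, which has room for the two-point example.
  On a one-element type \<open>f\<close> and \<open>g\<close> are multiples of \<open>h\<close> and
  the left-hand side of the inequality is 0, so no smaller constant could be refuted there.\<close>

theorem proposition1:
  fixes K :: "complex set"
  assumes "K = UNIV \<or> K = \<real>"
  shows
    "(\<forall>(M :: 'a measure) f g h \<phi> \<Phi> \<gamma> \<Gamma>. gruess_data K M f g h \<phi> \<Phi> \<gamma> \<Gamma> \<longrightarrow>
        (accretive_cond M h f \<phi> \<Phi> \<longleftrightarrow> ball_cond M h f \<phi> \<Phi>) \<and>
        (accretive_cond M h g \<gamma> \<Gamma> \<longleftrightarrow> ball_cond M h g \<gamma> \<Gamma>) \<and>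
        (accretive_cond M h f \<phi> \<Phi> \<and> accretive_cond M h g \<gamma> \<Gamma> \<longrightarrow>
           gruess_ineq (1 / 4) M f g h \<phi> \<Phi> \<gamma> \<Gamma>)) \<and>
     (\<forall>C<1/4. \<not> (\<forall>(M :: real measure) f g h \<phi> \<Phi> \<gamma> \<Gamma>.
        gruess_data K M f g h \<phi> \<Phi> \<gamma> \<Gamma> \<and>
        accretive_cond M h f \<phi> \<Phi> \<and> accretive_cond M h g \<gamma> \<Gamma> \<longrightarrow>
        gruess_ineq C M f g h \<phi> \<Phi> \<gamma> \<Gamma>))"
proof (intro conjI allI impI)
  fix M :: "'a measure" and f g h \<phi> \<Phi> \<gamma> \<Gamma>
  assume "gruess_data K M f g h \<phi> \<Phi> \<gamma> \<Gamma>"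
  \<comment> \<open>The real case is contained in the complex one, so the estimates are needed only
    over \<open>UNIV\<close>.\<close>
  then have L2: "f \<in> L2 M UNIV" "g \<in> L2 M UNIV" "h \<in> L2 M UNIV"
    and h1: "(\<integral>s. (cmod (h s))\<^sup>2 \<partial>M) = 1"
    and R: "Re (\<Phi> * cnj \<phi>) > 0" "Re (\<Gamma> * cnj \<gamma>) > 0"
    using L2_mono[of K UNIV M] by (auto simp: gruess_data_def)
  show "accretive_cond M h f \<phi> \<Phi> \<longleftrightarrow> ball_cond M h f \<phi> \<Phi>"
    "accretive_cond M h g \<gamma> \<Gamma> \<longleftrightarrow> ball_cond M h g \<gamma> \<Gamma>"
    using L2 h1 by (simp_all add: accretive_cond_iff_ball_cond)
  assume "accretive_cond M h f \<phi> \<Phi> \<and> accretive_cond M h g \<gamma> \<Gamma>"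
  then show "gruess_ineq (1 / 4) M f g h \<phi> \<Phi> \<gamma> \<Gamma>"
    using gruess_inequality[OF L2 h1 R] by blast
next
  fix C :: real
  assume "C < 1 / 4"
  then show "\<not> (\<forall>(M :: real measure) f g h \<phi> \<Phi> \<gamma> \<Gamma>.
        gruess_data K M f g h \<phi> \<Phi> \<gamma> \<Gamma> \<and>
        accretive_cond M h f \<phi> \<Phi> \<and> accretive_cond M h g \<gamma> \<Gamma> \<longrightarrow>
        gruess_ineq C M f g h \<phi> \<Phi> \<gamma> \<Gamma>)"
    using gruess_ineq_best_constant[OF assms] by (meson not_le)
qed

end
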